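(* If $C$ is a conjugation on the Hardy-Hilbert space $H^{2}$, then there exists a unitary operator $T:H^{2}\rightarrow H^{2}$ such that $TC=C_{1}T$, where $C_{1}f(z)=\overline{f(\overline{z})}$ for $f\in H^{2}$.
   Context: A conjugation on a separable Hilbert space $\mathcal H$ is an antilinear operator $C:\mathcal H\rightarrow\mathcal H$ such that $C^{2}=I$ and $\langle Cf,Cg\rangle=\langle g,f\rangle$ for all $f,g\in\mathcal H$. The Hardy-Hilbert space $H^{2}$ consists of all analytic functions $f(z)=\sum_{n=0}^{\infty}a_{n}z^{n}$ on the open unit disk $\mathbb D$ with $\sum_{n=0}^{\infty}|a_{n}|^{2}<\infty$, with the inner product for which $\{z^{n}:n=0,1,2,\ldots\}$ is an orthonormal basis. The map $C_{1}:H^{2}\to H^{2}$, $C_{1}f(z)=\overline{f(\overline{z})}$, is a conjugation on $H^{2}$. *)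

theory Defs
  imports "HOL-Complex_Analysis.Complex_Analysis"
begin

definition taylor_coeff :: "(complex \<Rightarrow> complex) \<Rightarrow> nat \<Rightarrow> complex" where
  "taylor_coeff f n = (deriv ^^ n) f 0 / fact n"

text \<open>An element of the Hardy space is a function on the open unit disk. It is represented by its
  extension by zero to the whole plane, so that equality in HOL is equality on the disk and the
  vector space operations are the pointwise ones.\<close>

definition H2 :: "(complex \<Rightarrow> complex) set" where
  "H2 = {f. f analytic_on ball 0 1 \<and> (\<forall>z. z \<notin> ball 0 1 \<longrightarrow> f z = 0) \<and>
            summable (\<lambda>n. (cmod (taylor_coeff f n))\<^sup>2)}"

text \<open>The inner product that makes the monomials an orthonormal basis, linear in the first
  argument; the series converges absolutely for elements of \<^term>\<open>H2\<close>.\<close>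

definition H2_inner :: "(complex \<Rightarrow> complex) \<Rightarrow> (complex \<Rightarrow> complex) \<Rightarrow> complex" where
  "H2_inner f g = (\<Sum>n. taylor_coeff f n * cnj (taylor_coeff g n))"

text \<open>Operators on a complex Hilbert space whose underlying set \<open>V\<close> consists of complex-valued
  functions with the pointwise operations and whose inner product is \<open>ip\<close>. Operators are total
  functions in HOL; only their values on \<open>V\<close> are relevant.\<close>

definition linear_operator_on :: "('a \<Rightarrow> complex) set \<Rightarrow> (('a \<Rightarrow> complex) \<Rightarrow> 'a \<Rightarrow> complex) \<Rightarrow> bool" where
  "linear_operator_on V T \<longleftrightarrow> T \<in> V \<rightarrow> V \<and>
     (\<forall>f\<in>V. \<forall>g\<in>V. \<forall>a b. T (\<lambda>x. a * f x + b * g x) = (\<lambda>x. a * T f x + b * T g x))"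

definition antilinear_operator_on :: "('a \<Rightarrow> complex) set \<Rightarrow> (('a \<Rightarrow> complex) \<Rightarrow> 'a \<Rightarrow> complex) \<Rightarrow> bool" where
  "antilinear_operator_on V C \<longleftrightarrow> C \<in> V \<rightarrow> V \<and>
     (\<forall>f\<in>V. \<forall>g\<in>V. \<forall>a b. C (\<lambda>x. a * f x + b * g x) = (\<lambda>x. cnj a * C f x + cnj b * C g x))"

definition conjugation_on ::
  "('a \<Rightarrow> complex) set \<Rightarrow> (('a \<Rightarrow> complex) \<Rightarrow> ('a \<Rightarrow> complex) \<Rightarrow> complex) \<Rightarrow>
   (('a \<Rightarrow> complex) \<Rightarrow> 'a \<Rightarrow> complex) \<Rightarrow> bool" where
  "conjugation_on V ip C \<longleftrightarrow> antilinear_operator_on V C \<and> (\<forall>f\<in>V. C (C f) = f) \<and>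
     (\<forall>f\<in>V. \<forall>g\<in>V. ip (C f) (C g) = ip g f)"

definition unitary_on ::
  "('a \<Rightarrow> complex) set \<Rightarrow> (('a \<Rightarrow> complex) \<Rightarrow> ('a \<Rightarrow> complex) \<Rightarrow> complex) \<Rightarrow>
   (('a \<Rightarrow> complex) \<Rightarrow> 'a \<Rightarrow> complex) \<Rightarrow> bool" where
  "unitary_on V ip T \<longleftrightarrow> linear_operator_on V T \<and> bij_betw T V V \<and>
     (\<forall>f\<in>V. \<forall>g\<in>V. ip (T f) (T g) = ip f g)"

definition C1 :: "(complex \<Rightarrow> complex) \<Rightarrow> complex \<Rightarrow> complex" where
  "C1 f = (\<lambda>z. cnj (f (cnj z)))"

end

theory Submission
  imports Defs
begin

text \<open>A conjugation \<open>C\<close> acts like complex conjugation of coordinates once the coordinates are taken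
  in an orthonormal basis of \<open>C\<close>-fixed vectors. Indeed, if \<open>C e = e\<close> then
  \<open>\<langle>C f, e\<rangle> = \<langle>C f, C e\<rangle> = \<langle>e, f\<rangle> = cnj \<langle>f, e\<rangle>\<close>. The conjugation \<^term>\<open>C1\<close> conjugates the Taylor
  coefficients, that is, the coordinates in the basis of monomials, which it fixes. So the unitary
  operator that sends a fixed basis \<open>e\<^sub>0, e\<^sub>1, \<dots>\<close> of \<open>C\<close> to the monomials \<open>1, z, z\<^sup>2, \<dots>\<close> intertwines
  the two.

  A fixed basis exists by maximality. If \<open>S\<close> is a maximal orthonormal set of fixed vectors and \<open>f\<close> is
  orthogonal to \<open>S\<close>, then so are the fixed vectors \<open>f + C f\<close> and \<open>\<i> (C f - f)\<close>. By maximality both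
  vanish, hence \<open>f = 0\<close>, and \<open>S\<close> is complete (\<open>conjugation_fixed_basis_set\<close>). Bessel's inequality
  makes \<open>S\<close> countable, and a count of squared norms makes it infinite, so it can be enumerated by the
  natural numbers.

  All this is done in the space of square-summable sequences, with which the Hardy space is
  identified by Taylor coefficients. There, the coordinate map of a complete orthonormal sequence
  is a unitary operator (\<open>unitary_coordinates\<close>, the Riesz--Fischer theorem and Parseval's identity).\<close>

section \<open>The space of square-summable sequences\<close>

definition l2 :: "(nat \<Rightarrow> complex) set" where
  "l2 = {a. summable (\<lambda>n. (cmod (a n))\<^sup>2)}"

definition l2_inner :: "(nat \<Rightarrow> complex) \<Rightarrow> (nat \<Rightarrow> complex) \<Rightarrow> complex" where
  "l2_inner a b = (\<Sum>n. a n * cnj (b n))"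

definition sqnorm :: "(nat \<Rightarrow> complex) \<Rightarrow> real" where
  "sqnorm a = (\<Sum>n. (cmod (a n))\<^sup>2)"

definition unit_seq :: "nat \<Rightarrow> nat \<Rightarrow> complex" where
  "unit_seq m = (\<lambda>n. if n = m then 1 else 0)"

lemma l2_summable_inner:
  assumes "a \<in> l2" "b \<in> l2"
  shows "summable (\<lambda>n. a n * cnj (b n))"
proof (rule summable_comparison_test')
  show "summable (\<lambda>n. (cmod (a n))\<^sup>2 + (cmod (b n))\<^sup>2)"
    using assms by (auto simp: l2_def intro: summable_add)
  show "norm (a n * cnj (b n)) \<le> (cmod (a n))\<^sup>2 + (cmod (b n))\<^sup>2" if "n \<ge> 0" for n
    using sum_squares_bound[of "cmod (a n)" "cmod (b n)"]
      mult_nonneg_nonneg[OF norm_ge_zero[of "a n"] norm_ge_zero[of "b n"]]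
    unfolding norm_mult complex_mod_cnj by linarith
qed

lemma l2_lincomb:
  assumes "a \<in> l2" "b \<in> l2"
  shows "(\<lambda>n. x * a n + y * b n) \<in> l2"
proof -
  have "summable (\<lambda>n. (cmod (x * a n + y * b n))\<^sup>2)"
  proof (rule summable_comparison_test')
    show "summable (\<lambda>n. 2 * (cmod x)\<^sup>2 * (cmod (a n))\<^sup>2 + 2 * (cmod y)\<^sup>2 * (cmod (b n))\<^sup>2)"
      using assms by (auto simp: l2_def intro!: summable_add summable_mult)
    show "norm ((cmod (x * a n + y * b n))\<^sup>2) \<le> 2 * (cmod x)\<^sup>2 * (cmod (a n))\<^sup>2 + 2 * (cmod y)\<^sup>2 * (cmod (b n))\<^sup>2"
      if "n \<ge> 0" for n
    proof -
      have "(cmod (x * a n + y * b n))\<^sup>2 \<le> (cmod (x * a n) + cmod (y * b n))\<^sup>2"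
        by (intro power_mono norm_triangle_ineq) simp
      also have "\<dots> \<le> 2 * (cmod (x * a n))\<^sup>2 + 2 * (cmod (y * b n))\<^sup>2"
        using sum_squares_bound[of "cmod (x * a n)" "cmod (y * b n)"]
        by (simp add: power2_sum)
      finally show ?thesis by (simp add: norm_mult power_mult_distrib)
    qed
  qed
  then show ?thesis by (simp add: l2_def)
qed

lemma l2_zero: "(\<lambda>n. 0) \<in> l2"
  by (simp add: l2_def)

lemma l2_scale: "a \<in> l2 \<Longrightarrow> (\<lambda>n. x * a n) \<in> l2"
  using l2_lincomb[of a a x 0] by simp

lemma l2_diff: "a \<in> l2 \<Longrightarrow> b \<in> l2 \<Longrightarrow> (\<lambda>n. a n - b n) \<in> l2"
  using l2_lincomb[of a b 1 "-1"] by simp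

lemma l2_sum:
  assumes "finite F" "\<And>i. i \<in> F \<Longrightarrow> e i \<in> l2"
  shows "(\<lambda>n. \<Sum>i\<in>F. c i * e i n) \<in> l2"
  using assms
proof (induction F)
  case empty
  then show ?case by (simp add: l2_zero)
next
  case (insert i F)
  then show ?case
    using l2_lincomb[of "e i" "\<lambda>n. \<Sum>i\<in>F. c i * e i n" "c i" 1] by simp
qed

lemma l2_finite_support: "(\<And>n. n \<ge> K \<Longrightarrow> a n = 0) \<Longrightarrow> a \<in> l2"
  unfolding l2_def by (auto intro!: summable_finite[of "{..<K}"]) (meson leI)

lemma unit_seq_in_l2: "unit_seq m \<in> l2"
  by (rule l2_finite_support[of "Suc m"]) (auto simp: unit_seq_def)

lemma l2_inner_lincomb_left:
  assumes "a \<in> l2" "b \<in> l2" "d \<in> l2"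
  shows "l2_inner (\<lambda>n. x * a n + y * b n) d = x * l2_inner a d + y * l2_inner b d"
proof -
  have "(\<lambda>n. x * (a n * cnj (d n)) + y * (b n * cnj (d n))) sums (x * l2_inner a d + y * l2_inner b d)"
    unfolding l2_inner_def
    by (intro sums_add sums_mult summable_sums l2_summable_inner assms)
  then show ?thesis
    by (simp add: l2_inner_def sums_iff algebra_simps)
qed

lemma l2_inner_commute:
  assumes "a \<in> l2" "b \<in> l2"
  shows "l2_inner b a = cnj (l2_inner a b)"
  using bounded_linear.suminf[OF bounded_linear_cnj l2_summable_inner[OF assms]]
  by (simp add: l2_inner_def mult.commute)

lemma l2_inner_scale_left: "a \<in> l2 \<Longrightarrow> d \<in> l2 \<Longrightarrow> l2_inner (\<lambda>n. x * a n) d = x * l2_inner a d"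
  using l2_inner_lincomb_left[of a a d x 0] by simp

lemma l2_inner_diff_left:
  "a \<in> l2 \<Longrightarrow> b \<in> l2 \<Longrightarrow> d \<in> l2 \<Longrightarrow> l2_inner (\<lambda>n. a n - b n) d = l2_inner a d - l2_inner b d"
  using l2_inner_lincomb_left[of a b d 1 "-1"] by simp

lemma l2_inner_sum_left:
  assumes "finite F" "\<And>i. i \<in> F \<Longrightarrow> e i \<in> l2" "d \<in> l2"
  shows "l2_inner (\<lambda>n. \<Sum>i\<in>F. c i * e i n) d = (\<Sum>i\<in>F. c i * l2_inner (e i) d)"
  using assms
proof (induction F)
  case empty
  then show ?case by (simp add: l2_inner_def)
next
  case (insert i F)
  then show ?case
    using l2_inner_lincomb_left[of "e i" "\<lambda>n. \<Sum>i\<in>F. c i * e i n" d "c i" 1]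
    by (simp add: l2_sum)
qed

lemma l2_inner_self:
  assumes "a \<in> l2"
  shows "l2_inner a a = of_real (sqnorm a)"
proof -
  have "(\<lambda>n. complex_of_real ((cmod (a n))\<^sup>2)) sums of_real (sqnorm a)"
    unfolding sqnorm_def using assms
    by (intro sums_of_real summable_sums) (simp add: l2_def)
  then show ?thesis
    by (simp only: l2_inner_def sums_iff complex_norm_square)
qed

lemma sqnorm_nonneg: "a \<in> l2 \<Longrightarrow> sqnorm a \<ge> 0"
  by (simp add: l2_def sqnorm_def suminf_nonneg)

lemma sum_cmod_le_sqnorm: "a \<in> l2 \<Longrightarrow> finite F \<Longrightarrow> (\<Sum>n\<in>F. (cmod (a n))\<^sup>2) \<le> sqnorm a"
  by (simp add: l2_def sqnorm_def sum_le_suminf)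

lemma sqnorm_eq_0D: "a \<in> l2 \<Longrightarrow> sqnorm a = 0 \<Longrightarrow> a = (\<lambda>n. 0)"
  by (auto simp: l2_def sqnorm_def suminf_eq_zero_iff)

lemma sqnorm_scale: "a \<in> l2 \<Longrightarrow> sqnorm (\<lambda>n. x * a n) = (cmod x)\<^sup>2 * sqnorm a"
  by (simp add: sqnorm_def l2_def norm_mult power_mult_distrib suminf_mult)

lemma l2_inner_unit_seq_right: "l2_inner a (unit_seq m) = a m"
proof -
  have "(\<lambda>n. a n * cnj (unit_seq m n)) = (\<lambda>n. if n = m then a m else 0)"
    by (auto simp: unit_seq_def)
  then show ?thesis
    using sums_single[of m "\<lambda>_. a m"] by (simp add: l2_inner_def sums_iff)
qed

lemma l2_inner_unit_seq_left: "a \<in> l2 \<Longrightarrow> l2_inner (unit_seq m) a = cnj (a m)"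
  using l2_inner_commute[of a "unit_seq m"] by (simp add: unit_seq_in_l2 l2_inner_unit_seq_right)

lemma sqnorm_unit_seq: "sqnorm (unit_seq m) = 1"
  using l2_inner_self[OF unit_seq_in_l2, of m] l2_inner_unit_seq_right[of "unit_seq m" m]
  by (simp add: unit_seq_def)

text \<open>Partial sums suffice to bound a norm. This takes the place of completeness of the space: bounds
  on finite sums pass through coordinatewise limits.\<close>

lemma sqnorm_le:
  assumes "\<And>M. (\<Sum>m<M. (cmod (a m))\<^sup>2) \<le> B"
  shows "a \<in> l2" "sqnorm a \<le> B"
proof -
  have s: "summable (\<lambda>n. (cmod (a n))\<^sup>2)"
    by (rule bounded_imp_summable[of _ B])
      (use assms[of "Suc _"] in \<open>auto simp: lessThan_Suc_atMost\<close>)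
  then show "a \<in> l2" by (simp add: l2_def)
  show "sqnorm a \<le> B"
    unfolding sqnorm_def by (rule suminf_le_const[OF s assms])
qed

text \<open>The scalar \<open>x\<close> makes this also a polarization identity: the values \<open>x = 1\<close> and \<open>x = \<i>\<close>
  recover the real and the imaginary part of the inner product from norms.\<close>

lemma sqnorm_add:
  assumes "a \<in> l2" "b \<in> l2"
  shows "sqnorm (\<lambda>n. x * a n + b n) = (cmod x)\<^sup>2 * sqnorm a + sqnorm b + 2 * Re (x * l2_inner a b)"
proof -
  let ?w = "\<lambda>n. x * a n + 1 * b n"
  have w: "?w \<in> l2" using assms by (rule l2_lincomb)
  have aw: "l2_inner a ?w = cnj x * of_real (sqnorm a) + l2_inner a b"
    using assms w by (subst l2_inner_commute[OF w \<open>a \<in> l2\<close>])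
      (simp only: l2_inner_lincomb_left l2_inner_self, subst l2_inner_commute[of a b], auto)
  have bw: "l2_inner b ?w = cnj (x * l2_inner a b) + of_real (sqnorm b)"
    using assms w by (subst l2_inner_commute[OF w \<open>b \<in> l2\<close>])
      (simp only: l2_inner_lincomb_left l2_inner_self, auto)
  have "of_real (sqnorm ?w) = x * l2_inner a ?w + 1 * l2_inner b ?w"
    using assms w by (subst l2_inner_self[symmetric]) (simp_all only: l2_inner_lincomb_left)
  also have "\<dots> = of_real ((cmod x)\<^sup>2 * sqnorm a + sqnorm b) + (x * l2_inner a b + cnj (x * l2_inner a b))"
    unfolding aw bw of_real_add of_real_mult complex_norm_square by (simp add: algebra_simps)
  also have "\<dots> = of_real ((cmod x)\<^sup>2 * sqnorm a + sqnorm b + 2 * Re (x * l2_inner a b))"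
    by (simp only: complex_add_cnj of_real_add)
  finally show ?thesis by (simp only: of_real_eq_iff mult_1)
qed

section \<open>Orthonormal families\<close>

definition orthonormal :: "'i set \<Rightarrow> ('i \<Rightarrow> nat \<Rightarrow> complex) \<Rightarrow> bool" where
  "orthonormal I e \<longleftrightarrow> (\<forall>i\<in>I. e i \<in> l2) \<and>
     (\<forall>i\<in>I. \<forall>j\<in>I. l2_inner (e i) (e j) = (if i = j then 1 else 0))"

definition complete_family :: "'i set \<Rightarrow> ('i \<Rightarrow> nat \<Rightarrow> complex) \<Rightarrow> bool" where
  "complete_family I e \<longleftrightarrow> (\<forall>a\<in>l2. (\<forall>i\<in>I. l2_inner a (e i) = 0) \<longrightarrow> a = (\<lambda>n. 0))"

lemma orthonormalD:
  assumes "orthonormal I e"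
  shows "i \<in> I \<Longrightarrow> e i \<in> l2"
    "i \<in> I \<Longrightarrow> j \<in> I \<Longrightarrow> l2_inner (e i) (e j) = (if i = j then 1 else 0)"
  using assms by (auto simp: orthonormal_def)

lemma orthonormal_subset: "orthonormal I e \<Longrightarrow> J \<subseteq> I \<Longrightarrow> orthonormal J e"
  unfolding orthonormal_def by blast

lemma l2_inner_orthonormal_sum:
  assumes "orthonormal F e" "finite F" "j \<in> F"
  shows "l2_inner (\<lambda>n. \<Sum>i\<in>F. c i * e i n) (e j) = c j"
proof -
  have "l2_inner (\<lambda>n. \<Sum>i\<in>F. c i * e i n) (e j) = (\<Sum>i\<in>F. c i * l2_inner (e i) (e j))"
    using assms orthonormalD[OF assms(1)] by (intro l2_inner_sum_left) auto
  also have "\<dots> = (\<Sum>i\<in>F. if i = j then c i else 0)"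
    using assms orthonormalD[OF assms(1)] by (intro sum.cong) auto
  finally show ?thesis using assms by simp
qed

lemma sqnorm_orthonormal_sum:
  assumes "orthonormal F e" "finite F"
  shows "sqnorm (\<lambda>n. \<Sum>i\<in>F. c i * e i n) = (\<Sum>i\<in>F. (cmod (c i))\<^sup>2)"
proof -
  let ?p = "\<lambda>n. \<Sum>i\<in>F. c i * e i n"
  have p: "?p \<in> l2" using assms orthonormalD[OF assms(1)] by (intro l2_sum) auto
  have "complex_of_real (sqnorm ?p) = (\<Sum>i\<in>F. c i * l2_inner (e i) ?p)"
    using assms orthonormalD[OF assms(1)] p
    by (subst l2_inner_self[symmetric]) (auto intro!: l2_inner_sum_left)
  also have "\<dots> = (\<Sum>i\<in>F. c i * cnj (c i))"
  proof (rule sum.cong)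
    fix i assume i: "i \<in> F"
    have "l2_inner (e i) ?p = cnj (l2_inner ?p (e i))"
      using p orthonormalD(1)[OF assms(1) i] by (rule l2_inner_commute)
    then show "c i * l2_inner (e i) ?p = c i * cnj (c i)"
      using l2_inner_orthonormal_sum[OF assms i] by simp
  qed simp
  also have "\<dots> = of_real (\<Sum>i\<in>F. (cmod (c i))\<^sup>2)"
    by (simp only: of_real_sum complex_norm_square)
  finally show ?thesis by (simp only: of_real_eq_iff)
qed

text \<open>The vector \<open>a\<close> minus its projection to the span of the family has nonnegative norm.\<close>

lemma bessel:
  assumes "orthonormal F e" "finite F" "a \<in> l2"
  shows "(\<Sum>i\<in>F. (cmod (l2_inner a (e i)))\<^sup>2) \<le> sqnorm a"
proof -
  let ?c = "\<lambda>i. l2_inner a (e i)"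
  let ?p = "\<lambda>n. \<Sum>i\<in>F. ?c i * e i n"
  have p: "?p \<in> l2" using assms orthonormalD[OF assms(1)] by (intro l2_sum) auto
  have "l2_inner ?p a = (\<Sum>i\<in>F. ?c i * l2_inner (e i) a)"
    using assms orthonormalD[OF assms(1)] by (intro l2_inner_sum_left) auto
  also have "\<dots> = (\<Sum>i\<in>F. of_real ((cmod (?c i))\<^sup>2))"
  proof (rule sum.cong)
    fix i assume i: "i \<in> F"
    have "l2_inner (e i) a = cnj (?c i)"
      using assms(3) orthonormalD(1)[OF assms(1) i] by (rule l2_inner_commute)
    then show "?c i * l2_inner (e i) a = of_real ((cmod (?c i))\<^sup>2)"
      by (simp only: complex_norm_square)
  qed simp
  finally have pa: "l2_inner ?p a = of_real (\<Sum>i\<in>F. (cmod (?c i))\<^sup>2)" by simp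
  have "0 \<le> sqnorm (\<lambda>n. (-1) * ?p n + a n)"
    using l2_lincomb[OF p assms(3), of "-1" 1] by (intro sqnorm_nonneg) simp
  also have "\<dots> = sqnorm ?p + sqnorm a - 2 * (\<Sum>i\<in>F. (cmod (?c i))\<^sup>2)"
    using sqnorm_add[OF p assms(3), of "-1"] unfolding pa by simp
  finally show ?thesis
    unfolding sqnorm_orthonormal_sum[OF assms(1,2)] by simp
qed

text \<open>By Bessel's inequality for the unit sequence at \<open>n\<close>, the values \<open>|u n|\<^sup>2\<close> for \<open>u \<in> S\<close> have a
  bounded sum, so only countably many \<open>u \<in> S\<close> have a nonzero entry at \<open>n\<close>. Every element of \<open>S\<close> has
  a nonzero entry somewhere.\<close>

lemma orthonormal_set_countable:
  assumes "orthonormal S (\<lambda>u. u)"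
  shows "countable S"
proof -
  have "countable {u\<in>S. u n \<noteq> 0}" for n
  proof -
    have "(\<lambda>u. (cmod (u n))\<^sup>2) summable_on S"
    proof (rule nonneg_bdd_above_summable_on)
      have "(\<Sum>u\<in>F. (cmod (u n))\<^sup>2) \<le> 1" if F: "F \<subseteq> S" "finite F" for F
      proof -
        have "(\<Sum>u\<in>F. (cmod (u n))\<^sup>2) = (\<Sum>u\<in>F. (cmod (l2_inner (unit_seq n) u))\<^sup>2)"
          using F orthonormalD(1)[OF assms] by (intro sum.cong) (auto simp: l2_inner_unit_seq_left)
        also have "\<dots> \<le> 1"
          using bessel[OF orthonormal_subset[OF assms F(1)] F(2) unit_seq_in_l2[of n]]
          by (simp add: sqnorm_unit_seq)
        finally show ?thesis .
      qed
      then show "bdd_above (sum (\<lambda>u. (cmod (u n))\<^sup>2) ` {F. F \<subseteq> S \<and> finite F})"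
        by (auto intro!: bdd_aboveI2)
    qed simp
    then have "countable {u\<in>S. (cmod (u n))\<^sup>2 \<noteq> 0}"
      by (rule summable_countable_real)
    then show ?thesis by simp
  qed
  then have "countable (\<Union>n. {u\<in>S. u n \<noteq> 0})" by auto
  moreover have "S \<subseteq> (\<Union>n. {u\<in>S. u n \<noteq> 0})"
  proof
    fix u assume u: "u \<in> S"
    have "\<exists>n. u n \<noteq> 0"
    proof (rule ccontr)
      assume "\<nexists>n. u n \<noteq> 0"
      then have "l2_inner u u = 0" by (simp add: l2_inner_def)
      then show False using orthonormalD(2)[OF assms u u] by simp
    qed
    with u show "u \<in> (\<Union>n. {u\<in>S. u n \<noteq> 0})" by auto
  qed
  ultimately show ?thesis by (rule countable_subset[rotated])
qed

text \<open>If \<open>S\<close> were finite and complete, every unit sequence would be its own projection, which gives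
  \<open>(\<Sum>u\<in>S. |u n|\<^sup>2) = 1\<close> for every \<open>n\<close>. Summed over more than \<open>card S\<close> indices \<open>n\<close> this exceeds
  \<open>card S\<close>, while each of the unit vectors \<open>u\<close> contributes at most \<open>1\<close>.\<close>

lemma complete_orthonormal_set_infinite:
  assumes "orthonormal S (\<lambda>u. u)" "complete_family S (\<lambda>u. u)"
  shows "infinite S"
proof
  assume fin: "finite S"
  have one: "(\<Sum>u\<in>S. (cmod (u n))\<^sup>2) = 1" for n
  proof -
    let ?p = "\<lambda>k. \<Sum>u\<in>S. cnj (u n) * u k"
    have p: "?p \<in> l2" using fin orthonormalD(1)[OF assms(1)] by (intro l2_sum) auto
    have "(\<lambda>k. unit_seq n k - ?p k) = (\<lambda>k. 0)"
    proof -
      have "l2_inner (\<lambda>k. unit_seq n k - ?p k) u = 0" if u: "u \<in> S" for u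
        using l2_inner_orthonormal_sum[OF assms(1) fin u, of "\<lambda>u. cnj (u n)"]
          orthonormalD(1)[OF assms(1) u] p
        by (simp add: l2_inner_diff_left unit_seq_in_l2 l2_inner_unit_seq_left)
      then show ?thesis
        using assms(2) l2_diff[OF unit_seq_in_l2 p, of n] unfolding complete_family_def by blast
    qed
    then have "unit_seq n = ?p" by (auto simp: fun_eq_iff)
    then show ?thesis
      using sqnorm_orthonormal_sum[OF assms(1) fin, of "\<lambda>u. cnj (u n)"] sqnorm_unit_seq[of n]
      by simp
  qed
  let ?N = "Suc (card S)"
  have "real ?N = (\<Sum>n<?N. \<Sum>u\<in>S. (cmod (u n))\<^sup>2)"
    using one by simp
  also have "\<dots> = (\<Sum>u\<in>S. \<Sum>n<?N. (cmod (u n))\<^sup>2)"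
    by (rule sum.swap)
  also have "\<dots> \<le> (\<Sum>u\<in>S. 1)"
  proof (rule sum_mono)
    fix u assume u: "u \<in> S"
    have "complex_of_real (sqnorm u) = 1"
      using orthonormalD[OF assms(1) u] u l2_inner_self[of u] by simp
    then show "(\<Sum>n<?N. (cmod (u n))\<^sup>2) \<le> 1"
      using sum_cmod_le_sqnorm[OF orthonormalD(1)[OF assms(1) u], of "{..<?N}"] by simp
  qed
  finally show False by simp
qed

section \<open>Coefficients and synthesis with respect to an orthonormal sequence\<close>

definition coordinates :: "(nat \<Rightarrow> nat \<Rightarrow> complex) \<Rightarrow> (nat \<Rightarrow> complex) \<Rightarrow> nat \<Rightarrow> complex" where
  "coordinates e a = (\<lambda>k. l2_inner a (e k))"

text \<open>The would-be inverse of the coordinate map. The sum \<open>\<Sum>k. c k e\<^sub>k\<close> is formed entry by entry, which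
  avoids convergence in norm.\<close>

definition synthesis :: "(nat \<Rightarrow> nat \<Rightarrow> complex) \<Rightarrow> (nat \<Rightarrow> complex) \<Rightarrow> nat \<Rightarrow> complex" where
  "synthesis e c = (\<lambda>m. \<Sum>k. c k * e k m)"

context
  fixes e :: "nat \<Rightarrow> nat \<Rightarrow> complex"
  assumes orth: "orthonormal UNIV e"
begin

lemma coordinates_contraction:
  assumes "a \<in> l2"
  shows "coordinates e a \<in> l2" "sqnorm (coordinates e a) \<le> sqnorm a"
proof -
  have "(\<Sum>m<M. (cmod (coordinates e a m))\<^sup>2) \<le> sqnorm a" for M
    unfolding coordinates_def by (rule bessel) (use assms orth orthonormal_subset in auto)
  then show "coordinates e a \<in> l2" "sqnorm (coordinates e a) \<le> sqnorm a"
    using sqnorm_le[of "coordinates e a" "sqnorm a"] by blast+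
qed

lemma coordinates_lincomb:
  "a \<in> l2 \<Longrightarrow> b \<in> l2 \<Longrightarrow> coordinates e (\<lambda>n. x * a n + y * b n) = (\<lambda>k. x * coordinates e a k + y * coordinates e b k)"
  by (simp add: coordinates_def l2_inner_lincomb_left orthonormalD(1)[OF orth])

text \<open>At the entry \<open>m\<close> the series is the inner product of \<open>c\<close> with the coordinates of the unit sequence
  at \<open>m\<close>, which are square-summable by Bessel's inequality.\<close>

lemma synthesis_sums:
  assumes "c \<in> l2"
  shows "(\<lambda>k. c k * e k m) sums synthesis e c m"
proof -
  have "coordinates e (unit_seq m) = (\<lambda>k. cnj (e k m))"
    by (simp add: coordinates_def l2_inner_unit_seq_left orthonormalD(1)[OF orth])
  then have "(\<lambda>k. cnj (e k m)) \<in> l2"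
    using coordinates_contraction(1)[OF unit_seq_in_l2[of m]] by simp
  from l2_summable_inner[OF assms this] show ?thesis
    by (simp add: synthesis_def summable_sums)
qed

text \<open>Partial sums of \<open>\<Sum>k. c k e\<^sub>k\<close> have norm at most that of \<open>c\<close> by orthonormality; the bound
  survives the entrywise limit.\<close>

lemma synthesis_contraction:
  assumes "c \<in> l2"
  shows "synthesis e c \<in> l2" "sqnorm (synthesis e c) \<le> sqnorm c"
proof -
  have "(\<Sum>m<M. (cmod (synthesis e c m))\<^sup>2) \<le> sqnorm c" for M
  proof (rule LIMSEQ_le_const2)
    show "(\<lambda>K. \<Sum>m<M. (cmod (\<Sum>k<K. c k * e k m))\<^sup>2) \<longlonglongrightarrow> (\<Sum>m<M. (cmod (synthesis e c m))\<^sup>2)"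
      using synthesis_sums[OF assms] unfolding sums_def by (intro tendsto_intros)
    have "(\<Sum>m<M. (cmod (\<Sum>k<K. c k * e k m))\<^sup>2) \<le> sqnorm c" for K
    proof -
      have "(\<Sum>m<M. (cmod (\<Sum>k<K. c k * e k m))\<^sup>2) \<le> sqnorm (\<lambda>m. \<Sum>k<K. c k * e k m)"
        by (intro sum_cmod_le_sqnorm l2_sum) (auto simp: orthonormalD(1)[OF orth])
      also have "\<dots> = (\<Sum>k<K. (cmod (c k))\<^sup>2)"
        using orth by (intro sqnorm_orthonormal_sum) (auto intro: orthonormal_subset)
      also have "\<dots> \<le> sqnorm c" using assms by (rule sum_cmod_le_sqnorm) simp
      finally show ?thesis .
    qed
    then show "\<exists>N. \<forall>K\<ge>N. (\<Sum>m<M. (cmod (\<Sum>k<K. c k * e k m))\<^sup>2) \<le> sqnorm c" by blast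
  qed
  then show "synthesis e c \<in> l2" "sqnorm (synthesis e c) \<le> sqnorm c"
    using sqnorm_le[of "synthesis e c" "sqnorm c"] by blast+
qed

lemma synthesis_diff:
  assumes "c \<in> l2" "d \<in> l2"
  shows "synthesis e (\<lambda>k. c k - d k) = (\<lambda>m. synthesis e c m - synthesis e d m)"
proof
  fix m
  have "(\<lambda>k. (c k - d k) * e k m) sums (synthesis e c m - synthesis e d m)"
    using sums_diff[OF synthesis_sums[OF assms(1)] synthesis_sums[OF assms(2)], of m]
    by (simp add: algebra_simps)
  then show "synthesis e (\<lambda>k. c k - d k) m = synthesis e c m - synthesis e d m"
    by (simp add: synthesis_def sums_iff)
qed

text \<open>The Riesz--Fischer theorem. The identity is orthonormality when \<open>c\<close> has finite support. It extends
  to all \<open>c\<close> because both maps are contractions and the tails of \<open>c\<close> tend to \<open>0\<close>.\<close>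

lemma coordinates_synthesis:
  assumes c: "c \<in> l2"
  shows "coordinates e (synthesis e c) = c"
proof
  fix j
  \<comment> \<open>\<open>?t K\<close> is the truncation of \<open>c\<close> to its first \<open>K\<close> entries and \<open>?r K\<close> the tail.\<close>
  let ?t = "\<lambda>K k. if k < K then c k else 0"
  let ?r = "\<lambda>K k. c k - ?t K k"
  have t: "?t K \<in> l2" for K by (rule l2_finite_support[of K]) simp
  have r: "?r K \<in> l2" for K using c t by (rule l2_diff)
  have st: "synthesis e (?t K) = (\<lambda>m. \<Sum>k<K. c k * e k m)" for K
  proof
    fix m
    have "(\<lambda>k. ?t K k * e k m) sums (\<Sum>k<K. ?t K k * e k m)"
      by (rule sums_finite) auto
    then show "synthesis e (?t K) m = (\<Sum>k<K. c k * e k m)"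
      by (simp add: synthesis_def sums_iff)
  qed
  have bound: "(cmod (coordinates e (synthesis e c) j - c j))\<^sup>2 \<le> sqnorm (?r K)" if "j < K" for K
  proof -
    have "coordinates e (synthesis e (?t K)) j = c j"
      using l2_inner_orthonormal_sum[OF orthonormal_subset[OF orth], of "{..<K}" j c] that
      by (simp add: coordinates_def st)
    then have "coordinates e (synthesis e c) j - c j = coordinates e (synthesis e (?r K)) j"
      using c t synthesis_contraction(1)
      by (simp only: synthesis_diff coordinates_def l2_inner_diff_left orthonormalD(1)[OF orth] UNIV_I)
    then have "(cmod (coordinates e (synthesis e c) j - c j))\<^sup>2 \<le> sqnorm (coordinates e (synthesis e (?r K)))"
      using sum_cmod_le_sqnorm[of "coordinates e (synthesis e (?r K))" "{j}"] r
      by (simp add: coordinates_contraction(1) synthesis_contraction(1))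
    also have "\<dots> \<le> sqnorm (?r K)"
      using coordinates_contraction(2)[OF synthesis_contraction(1)[OF r]] synthesis_contraction(2)[OF r]
      by (rule order_trans)
    finally show ?thesis .
  qed
  have "(\<lambda>K. sqnorm (?r K)) \<longlonglongrightarrow> 0"
  proof -
    have sm: "summable (\<lambda>n. (cmod (c n))\<^sup>2)" using c by (simp add: l2_def)
    have "sqnorm (?r K) = sqnorm c - (\<Sum>k<K. (cmod (c k))\<^sup>2)" for K
    proof -
      have "(\<lambda>k. if k < K then (cmod (c k))\<^sup>2 else 0) sums (\<Sum>k<K. (cmod (c k))\<^sup>2)"
        using sums_If_finite[of "\<lambda>k. k < K" "\<lambda>k. (cmod (c k))\<^sup>2"] by (simp add: lessThan_def)
      from sums_diff[OF summable_sums[OF sm] this]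
      have "(\<lambda>k. (cmod (c k))\<^sup>2 - (if k < K then (cmod (c k))\<^sup>2 else 0)) sums
              (sqnorm c - (\<Sum>k<K. (cmod (c k))\<^sup>2))" by (simp add: sqnorm_def)
      also have "(\<lambda>k. (cmod (c k))\<^sup>2 - (if k < K then (cmod (c k))\<^sup>2 else 0)) = (\<lambda>k. (cmod (?r K k))\<^sup>2)"
        by auto
      finally show ?thesis by (simp add: sqnorm_def sums_iff)
    qed
    moreover have "(\<lambda>K. sqnorm c - (\<Sum>k<K. (cmod (c k))\<^sup>2)) \<longlonglongrightarrow> sqnorm c - sqnorm c"
      using summable_LIMSEQ[OF sm] unfolding sqnorm_def by (intro tendsto_intros)
    ultimately show ?thesis by simp
  qed
  then have "(cmod (coordinates e (synthesis e c) j - c j))\<^sup>2 \<le> 0"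
    by (rule LIMSEQ_le_const) (use bound in \<open>auto intro!: exI[of _ "Suc j"]\<close>)
  then show "coordinates e (synthesis e c) j = c j" by simp
qed

text \<open>Both sides have the same coordinates, by the Riesz--Fischer theorem, and completeness says that
  coordinates determine the vector.\<close>

lemma synthesis_coordinates:
  assumes "complete_family UNIV e" "a \<in> l2"
  shows "synthesis e (coordinates e a) = a"
proof -
  let ?s = "synthesis e (coordinates e a)"
  have s: "?s \<in> l2" using assms(2) by (simp add: coordinates_contraction(1) synthesis_contraction(1))
  have "l2_inner ?s (e k) = l2_inner a (e k)" for k
    using fun_cong[OF coordinates_synthesis[OF coordinates_contraction(1)[OF assms(2)]], of k]
    by (simp add: coordinates_def)
  then have "l2_inner (\<lambda>n. ?s n - a n) (e k) = 0" for k
    using s assms(2) by (simp add: l2_inner_diff_left orthonormalD(1)[OF orth])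
  then have "(\<lambda>n. ?s n - a n) = (\<lambda>n. 0)"
    using assms(1) l2_diff[OF s assms(2)] by (simp add: complete_family_def)
  then show ?thesis by (simp add: fun_eq_iff)
qed

text \<open>Parseval's identity: a bijective contraction whose inverse is a contraction is an isometry.\<close>

lemma sqnorm_coordinates:
  assumes "complete_family UNIV e" "a \<in> l2"
  shows "sqnorm (coordinates e a) = sqnorm a"
  using coordinates_contraction[OF assms(2)] synthesis_contraction(2)[of "coordinates e a"]
    synthesis_coordinates[OF assms] by simp

lemma l2_inner_coordinates:
  assumes "complete_family UNIV e" "a \<in> l2" "b \<in> l2"
  shows "l2_inner (coordinates e a) (coordinates e b) = l2_inner a b"
proof -
  have *: "Re (x * l2_inner (coordinates e a) (coordinates e b)) = Re (x * l2_inner a b)" for x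
  proof -
    have "sqnorm (\<lambda>n. x * coordinates e a n + coordinates e b n) = sqnorm (\<lambda>n. x * a n + b n)"
      using sqnorm_coordinates[OF assms(1) l2_lincomb[OF assms(2,3), of x 1]]
        coordinates_lincomb[OF assms(2,3), of x 1] by simp
    then show ?thesis
      using sqnorm_add[OF assms(2,3), of x] sqnorm_coordinates[OF assms(1)] assms(2,3)
        sqnorm_add[OF coordinates_contraction(1)[OF assms(2)] coordinates_contraction(1)[OF assms(3)], of x]
      by simp
  qed
  show ?thesis
    using *[of 1] *[of \<i>] by (simp add: complex_eq_iff)
qed

lemma unitary_coordinates:
  assumes "complete_family UNIV e"
  shows "unitary_on l2 l2_inner (coordinates e)"
proof -
  have "bij_betw (coordinates e) l2 l2"
    by (rule bij_betw_byWitness[where f' = "synthesis e"])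
      (use synthesis_coordinates[OF assms] coordinates_synthesis coordinates_contraction(1)
        synthesis_contraction(1) in auto)
  then show ?thesis
    using coordinates_lincomb l2_inner_coordinates[OF assms] coordinates_contraction(1)
    by (simp add: unitary_on_def linear_operator_on_def)
qed

end

section \<open>Conjugations have fixed orthonormal bases\<close>

text \<open>Zorn's lemma gives a maximal orthonormal set \<open>S\<close> of fixed vectors. Maximality excludes nonzero
  fixed vectors orthogonal to \<open>S\<close>, since they could be normalized and added. The orthogonal
  complement of \<open>S\<close> is invariant under \<open>C\<close>, and each \<open>f\<close> in it is a combination of the fixed vectors
  \<open>f + C f\<close> and \<open>\<i> (C f - f)\<close>, so it is zero.\<close>

lemma conjugation_fixed_basis_set:
  assumes C: "conjugation_on l2 l2_inner C"
  obtains S where "orthonormal S (\<lambda>u. u)" "complete_family S (\<lambda>u. u)" "\<And>u. u \<in> S \<Longrightarrow> C u = u"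
proof -
  have C_mem: "C a \<in> l2" and C_C: "C (C a) = a" if "a \<in> l2" for a
    using C that by (auto simp: conjugation_on_def antilinear_operator_on_def)
  have C_lin: "C (\<lambda>n. x * a n + y * b n) = (\<lambda>n. cnj x * C a n + cnj y * C b n)"
    if "a \<in> l2" "b \<in> l2" for a b x y
    using C that unfolding conjugation_on_def antilinear_operator_on_def by blast
  have C_inner: "l2_inner (C a) (C b) = l2_inner b a" if "a \<in> l2" "b \<in> l2" for a b
    using C that by (auto simp: conjugation_on_def)

  define A where "A = {S. orthonormal S (\<lambda>u. u) \<and> (\<forall>u\<in>S. C u = u)}"
  have "\<exists>M\<in>A. \<forall>X\<in>A. M \<subseteq> X \<longrightarrow> X = M"
  proof (rule Zorn_Lemma, rule ballI)
    fix \<K> assume "\<K> \<in> chains A"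
    then have sub: "\<K> \<subseteq> A" and tot: "\<And>X Y. X \<in> \<K> \<Longrightarrow> Y \<in> \<K> \<Longrightarrow> X \<subseteq> Y \<or> Y \<subseteq> X"
      by (auto simp: chains_def chain_subset_def)
    have "l2_inner u v = (if u = v then 1 else 0)" if uv: "u \<in> \<Union>\<K>" "v \<in> \<Union>\<K>" for u v
    proof -
      obtain X Y where XY: "X \<in> \<K>" "u \<in> X" "Y \<in> \<K>" "v \<in> Y" using uv by blast
      with tot[OF XY(1,3)] obtain Z where "Z \<in> \<K>" "u \<in> Z" "v \<in> Z" by blast
      then show ?thesis using sub by (auto simp: A_def orthonormal_def)
    qed
    moreover have "u \<in> l2" "C u = u" if "u \<in> \<Union>\<K>" for u
      using sub that by (auto simp: A_def orthonormal_def)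
    ultimately show "\<Union>\<K> \<in> A" by (simp add: A_def orthonormal_def)
  qed
  then obtain S where S: "S \<in> A" and max: "\<And>X. X \<in> A \<Longrightarrow> S \<subseteq> X \<Longrightarrow> X = S" by blast
  have orth: "orthonormal S (\<lambda>u. u)" and fixS: "\<And>u. u \<in> S \<Longrightarrow> C u = u"
    using S by (auto simp: A_def)
  note S_l2 = orthonormalD(1)[OF orth]

  have fixed_0: "g = (\<lambda>n. 0)"
    if g: "g \<in> l2" "C g = g" and perp: "\<And>u. u \<in> S \<Longrightarrow> l2_inner g u = 0" for g
  proof (rule ccontr)
    assume "g \<noteq> (\<lambda>n. 0)"
    then have pos: "sqnorm g > 0"
      using g sqnorm_nonneg[of g] sqnorm_eq_0D[of g] by fastforce
    define v where "v = (\<lambda>n. complex_of_real (1 / sqrt (sqnorm g)) * g n)"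
    have v: "v \<in> l2" unfolding v_def using g(1) by (rule l2_scale)
    have Cv: "C v = v"
      unfolding v_def using C_lin[OF g(1) g(1), of "complex_of_real (1 / sqrt (sqnorm g))" 0] g(2)
      by simp
    have "sqnorm v = 1"
      unfolding v_def sqnorm_scale[OF g(1)] using pos by (simp add: norm_divide power_divide)
    then have vv: "l2_inner v v = 1" using l2_inner_self[OF v] by simp
    have vu: "l2_inner v u = 0" if u: "u \<in> S" for u
      unfolding v_def l2_inner_scale_left[OF g(1) S_l2[OF u]] perp[OF u] by simp
    have uv: "l2_inner u v = 0" if u: "u \<in> S" for u
      using l2_inner_commute[OF v S_l2[OF u]] vu[OF u] by simp
    have nin: "v \<notin> S"
    proof
      assume "v \<in> S"
      from vu[OF this] vv show False by simp
    qed
    have "orthonormal (insert v S) (\<lambda>u. u)"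
      unfolding orthonormal_def
    proof (intro conjI ballI)
      fix a assume "a \<in> insert v S"
      then show "a \<in> l2" using v S_l2 by blast
    next
      fix a b assume "a \<in> insert v S" "b \<in> insert v S"
      then consider "a = v" "b = v" | "a = v" "b \<in> S" | "a \<in> S" "b = v" | "a \<in> S" "b \<in> S"
        by blast
      then show "l2_inner a b = (if a = b then 1 else 0)"
      proof cases
        case 1
        then show ?thesis by (simp add: vv)
      next
        case 2
        then show ?thesis using nin by (auto simp: vu)
      next
        case 3
        then show ?thesis using nin by (auto simp: uv)
      next
        case 4
        then show ?thesis by (rule orthonormalD(2)[OF orth])
      qed
    qed
    then have "insert v S \<in> A" using Cv fixS unfolding A_def by blast
    then show False using max nin by blast
  qed

  have "f = (\<lambda>n. 0)" if f: "f \<in> l2" and perp: "\<And>u. u \<in> S \<Longrightarrow> l2_inner f u = 0" for f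
  proof -
    have Cperp: "l2_inner (C f) u = 0" if u: "u \<in> S" for u
      using C_inner[OF f S_l2[OF u]] fixS[OF u] l2_inner_commute[OF f S_l2[OF u]] perp[OF u] by simp
    \<comment> \<open>The vectors \<open>x f + cnj x C f\<close> are fixed by \<open>C\<close>; \<open>x = 1\<close> and \<open>x = -\<i>\<close> give the two needed.\<close>
    have comb: "(\<lambda>n. x * f n + y * C f n) = (\<lambda>n. 0)" if xy: "y = cnj x" for x y
    proof (rule fixed_0)
      show "(\<lambda>n. x * f n + y * C f n) \<in> l2" using f C_mem[OF f] by (rule l2_lincomb)
      show "C (\<lambda>n. x * f n + y * C f n) = (\<lambda>n. x * f n + y * C f n)"
        using xy by (simp add: C_lin[OF f C_mem[OF f]] C_C[OF f] add.commute)
      show "l2_inner (\<lambda>n. x * f n + y * C f n) u = 0" if u: "u \<in> S" for u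
        by (simp add: l2_inner_lincomb_left[OF f C_mem[OF f] S_l2[OF u]] perp[OF u] Cperp[OF u])
    qed
    have "f n = 0" for n
    proof -
      have "f n + C f n = 0" using fun_cong[OF comb[where x = 1 and y = 1], of n] by simp
      moreover have "f n - C f n = 0"
        using fun_cong[OF comb[where x = "-\<i>" and y = \<i>], of n] by simp
      moreover have "2 * f n = (f n + C f n) + (f n - C f n)" by simp
      ultimately show ?thesis by (simp only:) simp
    qed
    then show ?thesis by auto
  qed
  then have "complete_family S (\<lambda>u. u)" by (simp add: complete_family_def)
  with orth fixS show ?thesis using that by blast
qed

lemma conjugation_fixed_basis:
  assumes "conjugation_on l2 l2_inner C"
  obtains e :: "nat \<Rightarrow> nat \<Rightarrow> complex"
  where "orthonormal UNIV e" "complete_family UNIV e" "\<And>k. C (e k) = e k"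
proof -
  obtain S where S: "orthonormal S (\<lambda>u. u)" "complete_family S (\<lambda>u. u)" "\<And>u. u \<in> S \<Longrightarrow> C u = u"
    using conjugation_fixed_basis_set[OF assms] by blast
  obtain e where e: "bij_betw e (UNIV :: nat set) S"
    using bij_betw_from_nat_into[OF orthonormal_set_countable[OF S(1)]
        complete_orthonormal_set_infinite[OF S(1,2)]] by blast
  then have inj: "inj e" and ran: "range e = S" by (auto simp: bij_betw_def)
  show ?thesis
  proof
    show "orthonormal UNIV e"
      using S(1) inj unfolding ran[symmetric] orthonormal_def by (auto dest: injD)
    show "complete_family UNIV e"
      using S(2) unfolding ran[symmetric] complete_family_def by auto
    show "C (e k) = e k" for k using S(3) ran by blast
  qed
qed

text \<open>The operator \<open>T\<close> takes coordinates with respect to a basis fixed by \<open>C\<close>.\<close>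

lemma conjugation_unitarily_equivalent_cnj:
  assumes C: "conjugation_on l2 l2_inner C"
  obtains T where "unitary_on l2 l2_inner T" "\<And>a. a \<in> l2 \<Longrightarrow> T (C a) = (\<lambda>k. cnj (T a k))"
proof -
  obtain e :: "nat \<Rightarrow> nat \<Rightarrow> complex"
    where e: "orthonormal UNIV e" "complete_family UNIV e" "\<And>k. C (e k) = e k"
    using conjugation_fixed_basis[OF C] by blast
  have "coordinates e (C a) k = cnj (coordinates e a k)" if a: "a \<in> l2" for a k
  proof -
    have ek: "e k \<in> l2" using orthonormalD(1)[OF e(1)] by simp
    have "l2_inner (C a) (C (e k)) = l2_inner (e k) a"
      using C a ek by (simp add: conjugation_on_def)
    then show ?thesis
      using l2_inner_commute[OF a ek] by (simp add: coordinates_def e(3))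
  qed
  then show ?thesis using that[OF unitary_coordinates[OF e(1,2)]] by blast
qed

section \<open>Taylor coefficients identify the Hardy space with the sequence space\<close>

definition power_series :: "(nat \<Rightarrow> complex) \<Rightarrow> complex \<Rightarrow> complex" where
  "power_series a = (\<lambda>z. if z \<in> ball 0 1 then \<Sum>n. a n * z ^ n else 0)"

text \<open>The powers of \<open>z\<close> are square-summable, so the series is an inner product (with the reproducing
  kernel of the Hardy space).\<close>

lemma l2_power_series_summable:
  assumes "a \<in> l2" "cmod z < 1"
  shows "summable (\<lambda>n. a n * z ^ n)"
proof -
  have "(\<lambda>n. cnj (z ^ n)) \<in> l2"
  proof -
    have "(cmod z)\<^sup>2 < 1" using assms(2) by (simp add: abs_square_less_1)
    then have "summable (\<lambda>n. ((cmod z)\<^sup>2) ^ n)" by (intro summable_geometric) simp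
    then show ?thesis
      by (simp add: l2_def norm_power mult.commute flip: power_mult)
  qed
  from l2_summable_inner[OF assms(1) this] show ?thesis by simp
qed

lemma power_series_lincomb:
  assumes "a \<in> l2" "b \<in> l2"
  shows "power_series (\<lambda>n. x * a n + y * b n) = (\<lambda>z. x * power_series a z + y * power_series b z)"
proof
  fix z
  show "power_series (\<lambda>n. x * a n + y * b n) z = x * power_series a z + y * power_series b z"
  proof (cases "z \<in> ball 0 1")
    case True
    then have z: "cmod z < 1" by simp
    have "(\<lambda>n. x * (a n * z ^ n) + y * (b n * z ^ n)) sums
            (x * (\<Sum>n. a n * z ^ n) + y * (\<Sum>n. b n * z ^ n))"
      using assms z by (intro sums_add sums_mult summable_sums l2_power_series_summable)
    then show ?thesis
      using True by (simp add: power_series_def sums_iff algebra_simps)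
  qed (simp add: power_series_def)
qed

lemma C1_power_series:
  assumes "a \<in> l2"
  shows "C1 (power_series a) = power_series (\<lambda>n. cnj (a n))"
proof
  fix z
  show "C1 (power_series a) z = power_series (\<lambda>n. cnj (a n)) z"
  proof (cases "z \<in> ball 0 1")
    case True
    then have "cmod (cnj z) < 1" by simp
    from bounded_linear.suminf[OF bounded_linear_cnj l2_power_series_summable[OF assms this]]
    show ?thesis using True by (simp add: C1_def power_series_def)
  qed (simp add: C1_def power_series_def)
qed

lemma power_series_H2:
  assumes "a \<in> l2"
  shows "power_series a \<in> H2" "taylor_coeff (power_series a) = a"
proof -
  have sums: "(\<lambda>n. a n * (z - 0) ^ n) sums power_series a z" if "z \<in> ball 0 1" for z
    using l2_power_series_summable[OF assms, of z] that
    by (simp add: power_series_def summable_sums)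
  have hol: "power_series a holomorphic_on ball 0 1"
    using power_series_holomorphic[OF sums] .
  have "eventually (\<lambda>z. (\<lambda>n. fps_nth (Abs_fps a) n * z ^ n) sums power_series a z) (nhds 0)"
    by (rule eventually_nhds_in_open[of "ball 0 1", THEN eventually_mono]) (use sums in auto)
  then have tc: "taylor_coeff (power_series a) n = a n" for n
    using fps_nth_fps_expansion[OF has_fps_expansionI, of "Abs_fps a" "power_series a" n]
    by (simp add: taylor_coeff_def)
  then show "taylor_coeff (power_series a) = a" by auto
  show "power_series a \<in> H2"
    using hol assms tc by (simp add: H2_def l2_def analytic_on_open power_series_def)
qed

lemma taylor_coeff_H2:
  assumes "f \<in> H2"
  shows "taylor_coeff f \<in> l2" "power_series (taylor_coeff f) = f"
proof -
  show "taylor_coeff f \<in> l2" using assms by (simp add: H2_def l2_def)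
  have hol: "f holomorphic_on ball 0 1" using assms by (simp add: H2_def analytic_imp_holomorphic)
  show "power_series (taylor_coeff f) = f"
  proof
    fix z
    show "power_series (taylor_coeff f) z = f z"
    proof (cases "z \<in> ball 0 1")
      case True
      from holomorphic_power_series[OF hol True] True show ?thesis
        by (simp add: power_series_def taylor_coeff_def sums_iff)
    next
      case False
      then show ?thesis using assms by (simp add: H2_def power_series_def)
    qed
  qed
qed

lemma H2_inner_eq: "H2_inner f g = l2_inner (taylor_coeff f) (taylor_coeff g)"
  by (simp add: H2_inner_def l2_inner_def)

text \<open>Transported from the linearity of the inverse map, which avoids iterated derivatives.\<close>

lemma taylor_coeff_lincomb:
  assumes "f \<in> H2" "g \<in> H2"
  shows "taylor_coeff (\<lambda>z. x * f z + y * g z) = (\<lambda>n. x * taylor_coeff f n + y * taylor_coeff g n)"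
proof -
  note f = taylor_coeff_H2[OF assms(1)] and g = taylor_coeff_H2[OF assms(2)]
  have "(\<lambda>z. x * f z + y * g z) = power_series (\<lambda>n. x * taylor_coeff f n + y * taylor_coeff g n)"
    using power_series_lincomb[OF f(1) g(1), of x y] f(2) g(2) by simp
  then show ?thesis
    using power_series_H2(2)[OF l2_lincomb[OF f(1) g(1), of x y]] by simp
qed

theorem theorem2p1:
  fixes C :: "(complex \<Rightarrow> complex) \<Rightarrow> (complex \<Rightarrow> complex)"
  assumes "conjugation_on H2 H2_inner C"
  shows "\<exists>T. unitary_on H2 H2_inner T \<and> (\<forall>f\<in>H2. T (C f) = C1 (T f))"
proof -
  have C_mem: "C f \<in> H2" and C_C: "C (C f) = f" if "f \<in> H2" for f
    using assms that by (auto simp: conjugation_on_def antilinear_operator_on_def)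
  have C_lin: "C (\<lambda>z. x * f z + y * g z) = (\<lambda>z. cnj x * C f z + cnj y * C g z)"
    if "f \<in> H2" "g \<in> H2" for f g x y
    using assms that unfolding conjugation_on_def antilinear_operator_on_def by blast
  have C_inner: "H2_inner (C f) (C g) = H2_inner g f" if "f \<in> H2" "g \<in> H2" for f g
    using assms that by (auto simp: conjugation_on_def)

  \<comment> \<open>The conjugation \<open>C\<close> transported to sequences.\<close>
  define D where "D a = taylor_coeff (C (power_series a))" for a
  have "conjugation_on l2 l2_inner D"
    unfolding conjugation_on_def antilinear_operator_on_def
  proof (intro conjI ballI allI funcsetI)
    show "D a \<in> l2" if "a \<in> l2" for a
      using that by (simp add: D_def taylor_coeff_H2 C_mem power_series_H2)
    show "D (\<lambda>n. x * a n + y * b n) = (\<lambda>n. cnj x * D a n + cnj y * D b n)"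
      if "a \<in> l2" "b \<in> l2" for a b x y
      using that
      by (simp add: D_def power_series_lincomb C_lin power_series_H2 C_mem taylor_coeff_lincomb)
    show "D (D a) = a" if "a \<in> l2" for a
      using that by (simp add: D_def taylor_coeff_H2 C_mem C_C power_series_H2)
    show "l2_inner (D a) (D b) = l2_inner b a" if "a \<in> l2" "b \<in> l2" for a b
      using that C_inner[of "power_series a" "power_series b"]
      by (simp add: D_def H2_inner_eq power_series_H2)
  qed
  then obtain T where T: "unitary_on l2 l2_inner T"
    and TD: "\<And>a. a \<in> l2 \<Longrightarrow> T (D a) = (\<lambda>k. cnj (T a k))"
    by (rule conjugation_unitarily_equivalent_cnj) blast
  have T_mem: "T a \<in> l2" if "a \<in> l2" for a
    using T that by (auto simp: unitary_on_def linear_operator_on_def)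
  have T_lin: "T (\<lambda>n. x * a n + y * b n) = (\<lambda>n. x * T a n + y * T b n)"
    if "a \<in> l2" "b \<in> l2" for a b x y
    using T that unfolding unitary_on_def linear_operator_on_def by blast
  have T_inner: "l2_inner (T a) (T b) = l2_inner a b" if "a \<in> l2" "b \<in> l2" for a b
    using T that by (auto simp: unitary_on_def)

  define U where "U = power_series \<circ> T \<circ> taylor_coeff"
  have "bij_betw taylor_coeff H2 l2"
    by (rule bij_betw_byWitness[where f' = power_series])
      (auto simp: taylor_coeff_H2 power_series_H2)
  moreover have "bij_betw power_series l2 H2"
    by (rule bij_betw_byWitness[where f' = taylor_coeff])
      (auto simp: taylor_coeff_H2 power_series_H2)
  moreover have "bij_betw T l2 l2" using T by (simp add: unitary_on_def)
  ultimately have "bij_betw U H2 H2"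
    unfolding U_def by (blast intro: bij_betw_trans)
  moreover have "linear_operator_on H2 U"
    unfolding linear_operator_on_def
  proof (intro conjI ballI allI funcsetI)
    show "U f \<in> H2" if "f \<in> H2" for f
      using that by (simp add: U_def power_series_H2 T_mem taylor_coeff_H2)
    show "U (\<lambda>z. x * f z + y * g z) = (\<lambda>z. x * U f z + y * U g z)" if "f \<in> H2" "g \<in> H2" for f g x y
      using that
      by (simp add: U_def taylor_coeff_lincomb T_lin taylor_coeff_H2 power_series_lincomb T_mem)
  qed
  moreover have "H2_inner (U f) (U g) = H2_inner f g" if "f \<in> H2" "g \<in> H2" for f g
    using that by (simp add: U_def H2_inner_eq power_series_H2 T_mem taylor_coeff_H2 T_inner)
  ultimately have "unitary_on H2 H2_inner U" by (simp add: unitary_on_def)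
  moreover have "U (C f) = C1 (U f)" if f: "f \<in> H2" for f
  proof -
    have "taylor_coeff (C f) = D (taylor_coeff f)"
      using f by (simp add: D_def taylor_coeff_H2)
    then show ?thesis
      using f by (simp add: U_def TD taylor_coeff_H2 C1_power_series T_mem)
  qed
  ultimately show ?thesis by blast
qed

end
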